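(* For all $\varepsilon\in(0,1)$, the ranking algorithm T-PPR$_\varepsilon$ is $\varepsilon$-spam resistant on all graph classes.
   Context: Graphs are finite directed graphs; every vertex with no out-edges carries a self-loop. A ranking vector on $G=(V,E)$ is $x:V\to[0,1]$ with $\sum_v x[v]=1$, $x[A]=\sum_{v\in A}x[v]$. $\mathrm{PR}(G,c,\varepsilon)$ is the stationary distribution of the chain which with probability $1-\varepsilon$ moves to a uniformly random out-neighbour and with probability $\varepsilon$ jumps to $c$. A ranking algorithm takes a graph $H$ and a non-empty trusted set $T\subseteq V_H$ and outputs a ranking vector on $H$. T-PPR$_\varepsilon$ on input $(H,T)$ outputs $\mathrm{PR}(H,c,\varepsilon)$ where $c\in T$ is a center chosen depending only on $T$. Spam model: for a graph $G$, non-empty $T_G\subseteq V_G$ and $P\subseteq V_G\setminus T_G$, $G_P$ is the set of graphs obtainable from $G$ by adding an arbitrary (possibly empty) set $S$ of new vertices and arbitrarily changing the out-edges of vertices in $S\cup P$; $S_H=V_H\setminus V_G$ for $H\in G_P$. A cost function is $C:V_G\setminus T_G\to[0,\infty)$ with total sum $1$, extended additively to sets. $f$ is $\sigma$-spam resistant on a class $\mathcal{A}$ if for all $G\in\mathcal{A}$ and non-empty $T_G\subseteq V_G$ there is a cost function $C$ such that for all $P\subseteq V_G\setminus T_G$ and $H\in G_P$ with $f(H,T_G)[S_H\cup P]>0$, $C(P)/f(H,T_G)[S_H\cup P]\ge\sigma$.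
   Formalization: The cost function is required to have total sum 1 only when some vertex is untrusted; if T_G = V_G no cost function with sum 1 exists (an empty sum is 0), so there the empty cost function is allowed. *)

theory Defs
  imports "HOL-Analysis.Analysis" "Graph_Theory.Pair_Digraph"
begin

text \<open>
  Vertices without out-edges are given a self-loop, so every vertex has an out-neighbour
  (possibly itself).
\<close>

definition ranking_graph :: "'v pair_pre_digraph \<Rightarrow> bool" where
  "ranking_graph G \<longleftrightarrow>
     pair_fin_digraph G \<and> (\<forall>v\<in>pverts G. \<exists>w. (v, w) \<in> parcs G)"

definition out_neighbours :: "'v pair_pre_digraph \<Rightarrow> 'v \<Rightarrow> 'v set" where
  "out_neighbours G u = {v. (u, v) \<in> parcs G}"

text \<open>
  Functions on the vertex set are represented by total functions vanishing outside it, so that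
  a ranking vector is determined by its values on the vertices.
\<close>

definition ranking_vector :: "'v pair_pre_digraph \<Rightarrow> ('v \<Rightarrow> real) \<Rightarrow> bool" where
  "ranking_vector G x \<longleftrightarrow>
     (\<forall>v\<in>pverts G. 0 \<le> x v \<and> x v \<le> 1) \<and>
     (\<forall>v. v \<notin> pverts G \<longrightarrow> x v = 0) \<and>
     (\<Sum>v\<in>pverts G. x v) = 1"

definition walk_prob :: "'v pair_pre_digraph \<Rightarrow> 'v \<Rightarrow> 'v \<Rightarrow> real" where
  "walk_prob G u v =
     (if v \<in> out_neighbours G u then 1 / real (card (out_neighbours G u)) else 0)"

definition pr_prob :: "'v pair_pre_digraph \<Rightarrow> 'v \<Rightarrow> real \<Rightarrow> 'v \<Rightarrow> 'v \<Rightarrow> real" where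
  "pr_prob G c \<epsilon> u v = (1 - \<epsilon>) * walk_prob G u v + \<epsilon> * (if v = c then 1 else 0)"

definition stationary ::
  "'v pair_pre_digraph \<Rightarrow> ('v \<Rightarrow> 'v \<Rightarrow> real) \<Rightarrow> ('v \<Rightarrow> real) \<Rightarrow> bool" where
  "stationary G K x \<longleftrightarrow>
     ranking_vector G x \<and> (\<forall>v\<in>pverts G. (\<Sum>u\<in>pverts G. x u * K u v) = x v)"

definition PR :: "'v pair_pre_digraph \<Rightarrow> 'v \<Rightarrow> real \<Rightarrow> 'v \<Rightarrow> real" where
  "PR G c \<epsilon> = (THE x. stationary G (pr_prob G c \<epsilon>) x)"

type_synonym 'v algorithm = "'v pair_pre_digraph \<Rightarrow> 'v set \<Rightarrow> 'v \<Rightarrow> real"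

definition ranking_algorithm :: "'v algorithm \<Rightarrow> bool" where
  "ranking_algorithm f \<longleftrightarrow>
     (\<forall>H T. ranking_graph H \<longrightarrow> T \<noteq> {} \<longrightarrow> T \<subseteq> pverts H \<longrightarrow> ranking_vector H (f H T))"

definition center_choice :: "('v set \<Rightarrow> 'v) \<Rightarrow> bool" where
  "center_choice center \<longleftrightarrow> (\<forall>T. finite T \<longrightarrow> T \<noteq> {} \<longrightarrow> center T \<in> T)"

definition T_PPR :: "('v set \<Rightarrow> 'v) \<Rightarrow> real \<Rightarrow> 'v algorithm" where
  "T_PPR center \<epsilon> H T = PR H (center T) \<epsilon>"

text \<open>
  The new vertices and their edges are whatever the larger graph adds; only the out-edges of old
  vertices outside \<^term>\<open>P\<close> are prescribed.  In particular no such vertex points to a new one.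
\<close>

definition spam_graphs :: "'v pair_pre_digraph \<Rightarrow> 'v set \<Rightarrow> 'v pair_pre_digraph set" where
  "spam_graphs G P =
     {H. ranking_graph H \<and> pverts G \<subseteq> pverts H \<and>
         (\<forall>v\<in>pverts G - P. out_neighbours H v = out_neighbours G v)}"

text \<open>
  If all vertices are trusted, the only cost function is the empty one, whose sum is \<open>0\<close>;
  the normalisation is therefore imposed only when some vertex is untrusted.
\<close>

definition cost_function :: "'v pair_pre_digraph \<Rightarrow> 'v set \<Rightarrow> ('v \<Rightarrow> real) \<Rightarrow> bool" where
  "cost_function G T C \<longleftrightarrow>
     (\<forall>v\<in>pverts G - T. 0 \<le> C v) \<and>
     (pverts G - T \<noteq> {} \<longrightarrow> (\<Sum>v\<in>pverts G - T. C v) = 1)"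

definition spam_resistant ::
  "real \<Rightarrow> 'v pair_pre_digraph set \<Rightarrow> 'v algorithm \<Rightarrow> bool" where
  "spam_resistant \<sigma> \<A> f \<longleftrightarrow>
     (\<forall>G\<in>\<A>. \<forall>T. T \<noteq> {} \<longrightarrow> T \<subseteq> pverts G \<longrightarrow>
       (\<exists>C. cost_function G T C \<and>
         (\<forall>P H. P \<subseteq> pverts G - T \<longrightarrow> H \<in> spam_graphs G P \<longrightarrow>
           (let r = (\<Sum>v\<in>(pverts H - pverts G) \<union> P. f H T v)
            in r > 0 \<longrightarrow> (\<Sum>v\<in>P. C v) / r \<ge> \<sigma>))))"


lemma sum_walk_prob:
  assumes "ranking_graph G" "u \<in> pverts G"
  shows "(\<Sum>v\<in>pverts G. walk_prob G u v) = 1"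
proof -
  interpret pair_fin_digraph G using assms(1) by (simp add: ranking_graph_def)
  have sub: "out_neighbours G u \<subseteq> pverts G"
    by (auto simp: out_neighbours_def dest: in_arcsD2)
  have fin: "finite (out_neighbours G u)"
    using sub pair_finite_verts finite_subset by blast
  have ne: "out_neighbours G u \<noteq> {}"
    using assms by (auto simp: ranking_graph_def out_neighbours_def)
  have "(\<Sum>v\<in>pverts G. walk_prob G u v) = (\<Sum>v\<in>out_neighbours G u. walk_prob G u v)"
    by (rule sum.mono_neutral_right) (use sub pair_finite_verts in \<open>auto simp: walk_prob_def\<close>)
  also have "\<dots> = 1"
    using fin ne by (simp add: walk_prob_def)
  finally show ?thesis .
qed

lemma stationary_pr_prob_iff:
  assumes "ranking_vector G x"
  shows "stationary G (pr_prob G c \<epsilon>) x \<longleftrightarrow>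
    (\<forall>v\<in>pverts G. (1 - \<epsilon>) * (\<Sum>u\<in>pverts G. x u * walk_prob G u v) +
      \<epsilon> * (if v = c then 1 else 0) = x v)"
proof -
  have "(\<Sum>u\<in>pverts G. x u * pr_prob G c \<epsilon> u v) =
      (1 - \<epsilon>) * (\<Sum>u\<in>pverts G. x u * walk_prob G u v) + \<epsilon> * (if v = c then 1 else 0)" for v
  proof -
    have "(\<Sum>u\<in>pverts G. x u * pr_prob G c \<epsilon> u v) =
        (\<Sum>u\<in>pverts G. (1 - \<epsilon>) * (x u * walk_prob G u v) + (\<epsilon> * (if v = c then 1 else 0)) * x u)"
      by (intro sum.cong) (auto simp: pr_prob_def algebra_simps)
    also have "\<dots> = (1 - \<epsilon>) * (\<Sum>u\<in>pverts G. x u * walk_prob G u v) +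
        (\<epsilon> * (if v = c then 1 else 0)) * (\<Sum>u\<in>pverts G. x u)"
      by (simp add: sum.distrib sum_distrib_left)
    finally show ?thesis using assms by (simp add: ranking_vector_def)
  qed
  then show ?thesis using assms by (simp add: stationary_def)
qed

lemma stationary_unique:
  assumes G: "ranking_graph G" and eps: "0 < \<epsilon>" "\<epsilon> < 1"
    and x: "stationary G (pr_prob G c \<epsilon>) x" and y: "stationary G (pr_prob G c \<epsilon>) y"
  shows "x = y"
proof -
  interpret pair_fin_digraph G using G by (simp add: ranking_graph_def)
  let ?V = "pverts G"
  define d where "d v = x v - y v" for v
  have rx: "ranking_vector G x" and ry: "ranking_vector G y"
    using x y by (auto simp: stationary_def)
  have d_eq: "d v = (1 - \<epsilon>) * (\<Sum>u\<in>?V. d u * walk_prob G u v)" if "v \<in> ?V" for v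
  proof -
    have "(1 - \<epsilon>) * (\<Sum>u\<in>?V. d u * walk_prob G u v) =
        (1 - \<epsilon>) * (\<Sum>u\<in>?V. x u * walk_prob G u v) - (1 - \<epsilon>) * (\<Sum>u\<in>?V. y u * walk_prob G u v)"
      by (simp add: d_def left_diff_distrib sum_subtractf right_diff_distrib)
    moreover have "(1 - \<epsilon>) * (\<Sum>u\<in>?V. x u * walk_prob G u v) + \<epsilon> * (if v = c then 1 else 0) = x v"
      using x that stationary_pr_prob_iff[OF rx] by blast
    moreover have "(1 - \<epsilon>) * (\<Sum>u\<in>?V. y u * walk_prob G u v) + \<epsilon> * (if v = c then 1 else 0) = y v"
      using y that stationary_pr_prob_iff[OF ry] by blast
    ultimately show ?thesis unfolding d_def[of v] by linarith
  qed
  have wp: "walk_prob G u v \<ge> 0" for u v by (simp add: walk_prob_def)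
  have "(\<Sum>v\<in>?V. \<bar>d v\<bar>) \<le> (\<Sum>v\<in>?V. (1 - \<epsilon>) * (\<Sum>u\<in>?V. \<bar>d u\<bar> * walk_prob G u v))"
  proof (rule sum_mono)
    fix v assume v: "v \<in> ?V"
    have "\<bar>d v\<bar> = (1 - \<epsilon>) * \<bar>\<Sum>u\<in>?V. d u * walk_prob G u v\<bar>"
      using d_eq[OF v] eps by (simp add: abs_mult)
    also have "\<dots> \<le> (1 - \<epsilon>) * (\<Sum>u\<in>?V. \<bar>d u * walk_prob G u v\<bar>)"
      using eps by (intro mult_left_mono sum_abs) auto
    also have "\<dots> = (1 - \<epsilon>) * (\<Sum>u\<in>?V. \<bar>d u\<bar> * walk_prob G u v)"
      using wp by (simp add: abs_mult)
    finally show "\<bar>d v\<bar> \<le> (1 - \<epsilon>) * (\<Sum>u\<in>?V. \<bar>d u\<bar> * walk_prob G u v)" .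
  qed
  also have "\<dots> = (1 - \<epsilon>) * (\<Sum>v\<in>?V. \<Sum>u\<in>?V. \<bar>d u\<bar> * walk_prob G u v)"
    by (simp add: sum_distrib_left)
  also have "(\<Sum>v\<in>?V. \<Sum>u\<in>?V. \<bar>d u\<bar> * walk_prob G u v) =
      (\<Sum>u\<in>?V. \<bar>d u\<bar> * (\<Sum>v\<in>?V. walk_prob G u v))"
    by (subst sum.swap) (simp add: sum_distrib_left)
  also have "\<dots> = (\<Sum>u\<in>?V. \<bar>d u\<bar>)"
    using sum_walk_prob[OF G] by simp
  finally have "\<epsilon> * (\<Sum>v\<in>?V. \<bar>d v\<bar>) \<le> 0" by (simp add: algebra_simps)
  then have "(\<Sum>v\<in>?V. \<bar>d v\<bar>) \<le> 0"
    using eps by (simp add: mult_le_0_iff)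
  then have "(\<Sum>v\<in>?V. \<bar>d v\<bar>) = 0"
    by (intro antisym sum_nonneg) auto
  then have "\<forall>v\<in>?V. d v = 0"
    using pair_finite_verts by (simp add: sum_nonneg_eq_0_iff)
  then show ?thesis
    using rx ry by (fastforce simp: d_def ranking_vector_def)
qed

lemma stationary_exists:
  assumes G: "ranking_graph G" and c: "c \<in> pverts G" and eps: "0 < \<epsilon>" "\<epsilon> < 1"
  shows "\<exists>x. stationary G (pr_prob G c \<epsilon>) x"
proof -
  interpret pair_fin_digraph G using G by (simp add: ranking_graph_def)
  let ?V = "pverts G"
  define p :: "nat \<Rightarrow> 'a \<Rightarrow> real" where
    "p = rec_nat (\<lambda>v. if v = c then 1 else 0)
           (\<lambda>_ q v. \<Sum>u\<in>?V. q u * walk_prob G u v)"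
  have p0: "p 0 v = (if v = c then 1 else 0)" for v by (simp add: p_def)
  have pS: "p (Suc k) v = (\<Sum>u\<in>?V. p k u * walk_prob G u v)" for k v by (simp add: p_def)
  have wp: "walk_prob G u v \<ge> 0" for u v by (simp add: walk_prob_def)
  have wp_out: "walk_prob G u v = 0" if "v \<notin> ?V" for u v
    using that by (auto simp: walk_prob_def out_neighbours_def dest: in_arcsD2)
  have p_nonneg: "p k v \<ge> 0" for k v
    by (induction k arbitrary: v) (auto simp: p0 pS wp intro!: sum_nonneg)
  have p_sum: "(\<Sum>v\<in>?V. p k v) = 1" for k
  proof (induction k)
    case 0
    then show ?case using c pair_finite_verts by (simp add: p0)
  next
    case (Suc k)
    have "(\<Sum>v\<in>?V. p (Suc k) v) = (\<Sum>u\<in>?V. p k u * (\<Sum>v\<in>?V. walk_prob G u v))"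
      unfolding pS by (subst sum.swap) (simp add: sum_distrib_left)
    also have "\<dots> = 1" using Suc sum_walk_prob[OF G] by simp
    finally show ?case .
  qed
  have p_out: "p k v = 0" if "v \<notin> ?V" for k v
    using that c by (cases k) (auto simp: p0 pS wp_out)
  have p_le: "p k v \<le> 1" for k v
  proof (cases "v \<in> ?V")
    case True
    then show ?thesis
      using member_le_sum[of v ?V "p k"] p_nonneg p_sum[of k] pair_finite_verts by auto
  qed (simp add: p_out)
  have geo: "(\<lambda>k. \<epsilon> * (1 - \<epsilon>) ^ k) sums 1"
    using sums_mult[OF geometric_sums[of "1 - \<epsilon>"], of \<epsilon>] eps by simp
  have sm: "summable (\<lambda>k. \<epsilon> * (1 - \<epsilon>) ^ k * p k v)" for v
    by (rule summable_comparison_test'[OF sums_summable[OF geo], where N = 0])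
      (use eps p_nonneg p_le in \<open>auto simp: abs_mult intro!: mult_left_le\<close>)
  define x where "x v = (\<Sum>k. \<epsilon> * (1 - \<epsilon>) ^ k * p k v)" for v
  have x_sums: "(\<lambda>k. \<epsilon> * (1 - \<epsilon>) ^ k * p k v) sums x v" for v
    unfolding x_def using sm by (rule summable_sums)
  have x_nonneg: "x v \<ge> 0" for v
    unfolding x_def by (intro suminf_nonneg sm) (use eps p_nonneg in auto)
  have x_out: "x v = 0" if "v \<notin> ?V" for v
    using that by (simp add: x_def p_out)
  have x_sum: "(\<Sum>v\<in>?V. x v) = 1"
  proof -
    have "(\<lambda>k. \<Sum>v\<in>?V. \<epsilon> * (1 - \<epsilon>) ^ k * p k v) sums (\<Sum>v\<in>?V. x v)"
      by (intro sums_sum x_sums)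
    moreover have "(\<Sum>v\<in>?V. \<epsilon> * (1 - \<epsilon>) ^ k * p k v) = \<epsilon> * (1 - \<epsilon>) ^ k" for k
      using p_sum[of k] by (simp flip: sum_distrib_left)
    ultimately show ?thesis using geo sums_unique2 by force
  qed
  have x_le: "x v \<le> 1" if "v \<in> ?V" for v
    using that member_le_sum[of v ?V x] x_nonneg x_sum pair_finite_verts by auto
  have rv: "ranking_vector G x"
    using x_nonneg x_out x_sum x_le by (simp add: ranking_vector_def)
  have "(1 - \<epsilon>) * (\<Sum>u\<in>?V. x u * walk_prob G u v) + \<epsilon> * (if v = c then 1 else 0) = x v" for v
  proof -
    have "(\<lambda>k. \<Sum>u\<in>?V. \<epsilon> * (1 - \<epsilon>) ^ k * p k u * walk_prob G u v) sums
        (\<Sum>u\<in>?V. x u * walk_prob G u v)"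
      by (intro sums_sum sums_mult2 x_sums)
    from sums_mult[OF this, of "1 - \<epsilon>"]
    have "(\<lambda>k. \<epsilon> * (1 - \<epsilon>) ^ Suc k * p (Suc k) v) sums
        ((1 - \<epsilon>) * (\<Sum>u\<in>?V. x u * walk_prob G u v))"
      by (simp add: pS sum_distrib_left mult_ac)
    then have "(\<lambda>k. \<epsilon> * (1 - \<epsilon>) ^ k * p k v) sums
        ((1 - \<epsilon>) * (\<Sum>u\<in>?V. x u * walk_prob G u v) + \<epsilon> * (1 - \<epsilon>) ^ 0 * p 0 v)"
      by (subst (asm) sums_Suc_iff) simp
    then show ?thesis using x_sums[of v] sums_unique2 by (fastforce simp: p0)
  qed
  then show ?thesis using stationary_pr_prob_iff[OF rv] by blast
qed

lemma stationary_PR: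
  assumes "ranking_graph G" "c \<in> pverts G" "0 < \<epsilon>" "\<epsilon> < 1"
  shows "stationary G (pr_prob G c \<epsilon>) (PR G c \<epsilon>)"
proof -
  have "\<exists>!x. stationary G (pr_prob G c \<epsilon>) x"
    using stationary_exists[OF assms] stationary_unique[OF assms(1,3,4)] by blast
  then show ?thesis unfolding PR_def by (rule theI')
qed

lemma ranking_algorithm_T_PPR:
  assumes "center_choice center" "0 < \<epsilon>" "\<epsilon> < 1"
  shows "ranking_algorithm (T_PPR center \<epsilon>)"
  unfolding ranking_algorithm_def
proof (intro allI impI)
  fix H :: "'a pair_pre_digraph" and T :: "'a set"
  assume H: "ranking_graph H" and T: "T \<noteq> {}" "T \<subseteq> pverts H"
  have "finite T"
    using H T(2) by (auto simp: ranking_graph_def dest: pair_fin_digraph.pair_finite_verts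
        intro: finite_subset)
  then have "center T \<in> pverts H"
    using assms(1) T by (auto simp: center_choice_def)
  then show "ranking_vector H (T_PPR center \<epsilon> H T)"
    using stationary_PR[OF H] assms by (simp add: T_PPR_def stationary_def)
qed

end

theory Submission
  imports Defs
begin

text \<open>
  The cost of a vertex is its PageRank \<open>x\<close> in the original graph, normalised over the untrusted
  vertices. Let \<open>y\<close> be the PageRank after spamming and \<open>A\<close> the set of original vertices outside
  \<open>P\<close>. Both chains make the same moves from \<open>A\<close>, so \<open>m = min x y\<close> is a supersolution on \<open>A\<close> of
  the stationarity equation of the chain killed on leaving \<open>A\<close>. Summing over \<open>A\<close>, the mass that
  \<open>m\<close> sends from \<open>A\<close> to \<open>P\<close> in one step is at least \<open>\<epsilon> (1 - m[A])\<close>. This flow is at most \<open>x[P]\<close>,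
  while \<open>1 - m[A]\<close> is at least \<open>1 - y[A]\<close>, the spammers' rank after the attack.
\<close>

lemma walk_prob_nonneg: "0 \<le> walk_prob G u v"
  by (simp add: walk_prob_def)

lemma ranking_vector_nonneg: "ranking_vector G x \<Longrightarrow> 0 \<le> x v"
  by (cases "v \<in> pverts G") (auto simp: ranking_vector_def)

lemma finite_pverts: "ranking_graph G \<Longrightarrow> finite (pverts G)"
  by (simp add: ranking_graph_def pair_fin_digraph.pair_finite_verts)

text \<open>Replacing \<open>x\<close> by the smaller \<open>m\<close> and cutting the stationarity
  sum down to \<open>A\<close> can only lower it, as \<open>x\<close> and the transition
  probabilities are nonnegative. Both graphs use this with the same \<open>A\<close> and
  \<open>m\<close>.\<close>

lemma stationary_ge_flow:
  assumes G: "ranking_graph G" and st: "stationary G (pr_prob G c \<epsilon>) x"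
    and eps: "\<epsilon> < 1" and A: "A \<subseteq> pverts G" and v: "v \<in> pverts G"
    and mx: "\<And>u. u \<in> A \<Longrightarrow> m u \<le> x u"
  shows "(1 - \<epsilon>) * (\<Sum>u\<in>A. m u * walk_prob G u v) + \<epsilon> * (if v = c then 1 else 0) \<le> x v"
proof -
  have rv: "ranking_vector G x" using st by (simp add: stationary_def)
  have "(\<Sum>u\<in>A. m u * walk_prob G u v) \<le> (\<Sum>u\<in>A. x u * walk_prob G u v)"
    by (intro sum_mono mult_right_mono mx walk_prob_nonneg)
  also have "\<dots> \<le> (\<Sum>u\<in>pverts G. x u * walk_prob G u v)"
    by (intro sum_mono2 finite_pverts[OF G] A mult_nonneg_nonneg walk_prob_nonneg
        ranking_vector_nonneg[OF rv])
  finally have "(1 - \<epsilon>) * (\<Sum>u\<in>A. m u * walk_prob G u v)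
      \<le> (1 - \<epsilon>) * (\<Sum>u\<in>pverts G. x u * walk_prob G u v)"
    using eps by (intro mult_left_mono) auto
  then show ?thesis
    using st v stationary_pr_prob_iff[OF rv, of c \<epsilon>] by force
qed

lemma spam_rank_le:
  assumes G: "ranking_graph G" and H: "H \<in> spam_graphs G P" and P: "P \<subseteq> pverts G"
    and c: "c \<in> pverts G - P" and eps: "0 < \<epsilon>" "\<epsilon> < 1"
  shows "\<epsilon> * (\<Sum>v\<in>(pverts H - pverts G) \<union> P. PR H c \<epsilon> v) \<le> (\<Sum>v\<in>P. PR G c \<epsilon> v)"
proof -
  have RH: "ranking_graph H" and sub: "pverts G \<subseteq> pverts H"
    and out: "\<And>v. v \<in> pverts G - P \<Longrightarrow> out_neighbours H v = out_neighbours G v"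
    using H by (auto simp: spam_graphs_def)
  define A where "A = pverts G - P"
  define x where "x = PR G c \<epsilon>"
  define y where "y = PR H c \<epsilon>"
  define m where "m v = min (x v) (y v)" for v
  have stx: "stationary G (pr_prob G c \<epsilon>) x" and sty: "stationary H (pr_prob H c \<epsilon>) y"
    unfolding x_def y_def using G RH sub c eps by (auto intro!: stationary_PR)
  have finG: "finite (pverts G)" and finH: "finite (pverts H)"
    using G RH by (auto intro: finite_pverts)
  have finA: "finite A" and finP: "finite P"
    using finG P by (auto simp: A_def intro: finite_subset)
  have AG: "A \<subseteq> pverts G" and AH: "A \<subseteq> pverts H" and GAP: "pverts G = A \<union> P"
    and disj: "A \<inter> P = {}" and cA: "c \<in> A"
    using sub P c by (auto simp: A_def)
  have wH: "walk_prob H u v = walk_prob G u v" if "u \<in> A" for u v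
    using out that by (simp add: A_def walk_prob_def)
  define F where "F v = (\<Sum>u\<in>A. m u * walk_prob G u v)" for v
  \<comment> \<open>Since \<open>walk_prob\<close> agrees on edges out of \<open>A\<close>, both
    \<open>x v\<close> and \<open>y v\<close> dominate the same expression in \<open>m\<close>,
    hence so does their minimum.\<close>
  have super: "(1 - \<epsilon>) * F v + \<epsilon> * (if v = c then 1 else 0) \<le> m v" if v: "v \<in> A" for v
  proof -
    have "(1 - \<epsilon>) * F v + \<epsilon> * (if v = c then 1 else 0) \<le> x v"
      unfolding F_def by (rule stationary_ge_flow[OF G stx eps(2) AG]) (use v AG in \<open>auto simp: m_def\<close>)
    moreover have "(1 - \<epsilon>) * (\<Sum>u\<in>A. m u * walk_prob H u v) + \<epsilon> * (if v = c then 1 else 0) \<le> y v"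
      by (rule stationary_ge_flow[OF RH sty eps(2) AH]) (use v AH in \<open>auto simp: m_def\<close>)
    ultimately show ?thesis by (simp add: F_def m_def wH)
  qed
  have flowP: "(1 - \<epsilon>) * F v \<le> x v" if v: "v \<in> P" for v
  proof -
    have "(1 - \<epsilon>) * F v + \<epsilon> * (if v = c then 1 else 0) \<le> x v"
      unfolding F_def by (rule stationary_ge_flow[OF G stx eps(2) AG]) (use v P in \<open>auto simp: m_def\<close>)
    then show ?thesis using v c by (auto split: if_splits)
  qed
  \<comment> \<open>In \<open>G\<close>, one step from \<open>A\<close> ends in \<open>A\<close> or
    in \<open>P\<close>, so the mass \<open>m\<close> on \<open>A\<close> splits into these two
    flows.\<close>
  have "(\<Sum>v\<in>A. F v) + (\<Sum>v\<in>P. F v) = (\<Sum>v\<in>pverts G. F v)"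
    unfolding GAP using finA finP disj by (simp add: sum.union_disjoint)
  also have "\<dots> = (\<Sum>u\<in>A. m u * (\<Sum>v\<in>pverts G. walk_prob G u v))"
    unfolding F_def by (subst sum.swap) (simp add: sum_distrib_left)
  also have "\<dots> = (\<Sum>u\<in>A. m u)"
    using sum_walk_prob[OF G] AG by (intro sum.cong) auto
  finally have Fsum: "(\<Sum>v\<in>A. F v) = (\<Sum>v\<in>A. m v) - (\<Sum>v\<in>P. F v)" by simp
  have "(\<Sum>v\<in>A. (1 - \<epsilon>) * F v + \<epsilon> * (if v = c then 1 else 0)) \<le> (\<Sum>v\<in>A. m v)"
    by (intro sum_mono super)
  \<comment> \<open>The center lies in \<open>A\<close>, so the jump term contributes exactly
    \<epsilon>.\<close>
  moreover have "(\<Sum>v\<in>A. (1 - \<epsilon>) * F v + \<epsilon> * (if v = c then 1 else 0)) = (1 - \<epsilon>) * (\<Sum>v\<in>A. F v) + \<epsilon>"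
    using finA cA by (simp add: sum.distrib flip: sum_distrib_left)
  ultimately have "\<epsilon> * (1 - (\<Sum>v\<in>A. m v)) \<le> (1 - \<epsilon>) * (\<Sum>v\<in>P. F v)"
    unfolding Fsum by (simp add: algebra_simps)
  also have "\<dots> \<le> (\<Sum>v\<in>P. x v)"
    unfolding sum_distrib_left by (intro sum_mono flowP)
  finally have main: "\<epsilon> * (1 - (\<Sum>v\<in>A. m v)) \<le> (\<Sum>v\<in>P. x v)" .
  have "(\<Sum>v\<in>(pverts H - pverts G) \<union> P. y v) + (\<Sum>v\<in>A. y v) = (\<Sum>v\<in>pverts H. y v)"
    using finH finA finP sub P
    by (subst sum.union_disjoint[symmetric]) (auto simp: A_def intro!: sum.cong)
  also have "\<dots> = 1"
    using sty by (simp add: stationary_def ranking_vector_def)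
  finally have "(\<Sum>v\<in>(pverts H - pverts G) \<union> P. y v) = 1 - (\<Sum>v\<in>A. y v)" by simp
  also have "\<dots> \<le> 1 - (\<Sum>v\<in>A. m v)"
    by (simp add: m_def sum_mono)
  finally have "\<epsilon> * (\<Sum>v\<in>(pverts H - pverts G) \<union> P. y v) \<le> \<epsilon> * (1 - (\<Sum>v\<in>A. m v))"
    using eps by (intro mult_left_mono) auto
  with main show ?thesis by (simp add: x_def y_def)
qed

text \<open>The untrusted vertices carry rank \<open>s\<close> at most 1, so normalising by
  \<open>s\<close> can only raise the values.\<close>

lemma cost_function_ge_ranking:
  assumes fin: "finite (pverts G)" and rv: "ranking_vector G x"
  obtains C where "cost_function G T C" "\<And>v. v \<in> pverts G - T \<Longrightarrow> x v \<le> C v"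
proof -
  let ?U = "pverts G - T"
  define s where "s = (\<Sum>v\<in>?U. x v)"
  have x0: "0 \<le> x v" for v by (rule ranking_vector_nonneg[OF rv])
  have finU: "finite ?U" using fin by simp
  have "s \<le> (\<Sum>v\<in>pverts G. x v)"
    unfolding s_def using fin x0 by (intro sum_mono2) auto
  then have s1: "s \<le> 1" using rv by (simp add: ranking_vector_def)
  have s0: "0 \<le> s" unfolding s_def using x0 by (simp add: sum_nonneg)
  show thesis
  proof (cases "s = 0")
    case True
    then have "\<forall>v\<in>?U. x v = 0"
      using finU x0 by (simp add: s_def sum_nonneg_eq_0_iff)
    \<comment> \<open>Here every cost function dominates \<open>x\<close> on \<open>?U\<close>, and
      the uniform one is taken. This covers an empty \<open>?U\<close>, for which no normalisation
      is demanded.\<close>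
    then show thesis
      using finU by (intro that[of "\<lambda>v. 1 / real (card ?U)"]) (auto simp: cost_function_def)
  next
    case False
    then have "cost_function G T (\<lambda>v. x v / s)"
      using x0 s0 by (auto simp: cost_function_def s_def simp flip: sum_divide_distrib)
    moreover have "x v \<le> x v / s" for v
      using False s0 s1 x0[of v] by (simp add: field_simps mult_left_le_one_le)
    ultimately show thesis by (rule that)
  qed
qed

theorem theorem3:
  fixes \<epsilon> :: real
    and center :: "'v set \<Rightarrow> 'v"
    and \<A> :: "'v pair_pre_digraph set"
  assumes "0 < \<epsilon>" and "\<epsilon> < 1"
    and "center_choice center"
    and "\<forall>G\<in>\<A>. ranking_graph G"
  shows "spam_resistant \<epsilon> \<A> (T_PPR center \<epsilon>)"
  unfolding spam_resistant_def
proof (intro ballI allI impI)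
  fix G T
  assume "G \<in> \<A>" and T: "T \<noteq> {}" "T \<subseteq> pverts G"
  then have G: "ranking_graph G" using assms(4) by blast
  have "finite T" using T(2) finite_pverts[OF G] by (rule finite_subset)
  then have cT: "center T \<in> T" using assms(3) T(1) by (simp add: center_choice_def)
  then have "center T \<in> pverts G" using T(2) by blast
  then have "ranking_vector G (PR G (center T) \<epsilon>)"
    using stationary_PR[OF G _ assms(1,2)] by (simp add: stationary_def)
  \<comment> \<open>\<open>C\<close> is fixed from \<open>G\<close> and \<open>T\<close> alone,
    before \<open>P\<close> and \<open>H\<close> are given.\<close>
  then obtain C where C: "cost_function G T C"
    and CG: "\<And>v. v \<in> pverts G - T \<Longrightarrow> PR G (center T) \<epsilon> v \<le> C v"
    using cost_function_ge_ranking[OF finite_pverts[OF G]] by blast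
  have "\<epsilon> \<le> (\<Sum>v\<in>P. C v) / r"
    if P: "P \<subseteq> pverts G - T" and H: "H \<in> spam_graphs G P"
      and r: "r = (\<Sum>v\<in>(pverts H - pverts G) \<union> P. T_PPR center \<epsilon> H T v)" "r > 0" for P H r
  proof -
    \<comment> \<open>The center depends only on \<open>T\<close>, so it is the same vertex in
      \<open>G\<close> and \<open>H\<close>; being trusted, it lies outside
      \<open>P\<close>.\<close>
    have "\<epsilon> * r \<le> (\<Sum>v\<in>P. PR G (center T) \<epsilon> v)"
      unfolding r(1) T_PPR_def
      by (rule spam_rank_le[OF G H _ _ assms(1,2)]) (use P cT T in auto)
    also have "\<dots> \<le> (\<Sum>v\<in>P. C v)"
      using P CG by (intro sum_mono) auto
    finally show ?thesis using r(2) by (simp add: pos_le_divide_eq)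
  qed
  with C show "\<exists>C. cost_function G T C \<and>
      (\<forall>P H. P \<subseteq> pverts G - T \<longrightarrow> H \<in> spam_graphs G P \<longrightarrow>
        (let r = (\<Sum>v\<in>(pverts H - pverts G) \<union> P. T_PPR center \<epsilon> H T v)
         in r > 0 \<longrightarrow> (\<Sum>v\<in>P. C v) / r \<ge> \<epsilon>))"
    unfolding Let_def by blast
qed

end
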